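(* A set $M\subseteq\omega$ is semi-r.e. if and only if $M$ is an initial segment of some recursively enumerable quasi-ordering $\preceq$ on $\omega$ such that $M$ is linearly ordered by $\preceq$ (any two elements of $M$ are $\preceq$-comparable).
   Context: $M\subseteq\omega$ is semi-r.e. if there is a partial recursive function $\psi$ of two variables such that for all $x,y\in\omega$: if $x\in M$ or $y\in M$, then $\psi(x,y)$ is defined and $\psi(x,y)\in\{x,y\}\cap M$. A quasi-ordering $\preceq$ on $\omega$ is recursively enumerable if the set of pairs $(x,y)$ with $x\preceq y$ is r.e. $M$ is an initial segment of $\preceq$ if every element of $M$ is strictly smaller (i.e. $x\preceq y$ and not $y\preceq x$) than every element of $\omega\setminus M$. *)

theory Defs
  imports Main
begin

text \<open>
  Partial recursive functions are those denoted by the following terms: they contain zero,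
  successor and the projections and are closed under composition, primitive recursion (on the
  first argument) and unbounded minimisation (over the first argument). Terms carry no arity:
  on the lists of any fixed length, every term denotes a partial recursive function of that
  many arguments. Zero, for instance,
  denotes the constant zero function of each arity, while a successor or projection applied to
  an unsuitable number of arguments is undefined.
\<close>

datatype recf =
    Zero
  | Succ
  | Proj nat
  | Comp recf "recf list"
  | Prec recf recf
  | Mu recf

text \<open>
  Composition is strict in all its arguments. Minimisation requires the minimised
  function to be defined (and nonzero) at all values before the first zero.
\<close>

fun eval :: "recf \<Rightarrow> nat list \<Rightarrow> nat option" where
  "eval Zero xs = Some 0"
| "eval Succ xs = (case xs of [x] \<Rightarrow> Some (Suc x) | _ \<Rightarrow> None)"
| "eval (Proj i) xs = (if i < length xs then Some (xs ! i) else None)"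
| "eval (Comp f gs) xs =
    (if \<forall>g\<in>set gs. eval g xs \<noteq> None then eval f (map (\<lambda>g. the (eval g xs)) gs) else None)"
| "eval (Prec f g) xs =
    (case xs of
       [] \<Rightarrow> None
     | n # ys \<Rightarrow>
         rec_nat (eval f ys) (\<lambda>m r. Option.bind r (\<lambda>v. eval g (m # v # ys))) n)"
| "eval (Mu f) xs =
    (if \<exists>n. eval f (n # xs) = Some 0 \<and> (\<forall>m<n. eval f (m # xs) \<noteq> None)
     then Some (LEAST n. eval f (n # xs) = Some 0)
     else None)"

definition partial_recursive2 :: "(nat \<times> nat \<rightharpoonup> nat) \<Rightarrow> bool" where
  "partial_recursive2 \<psi> \<longleftrightarrow> (\<exists>f. \<forall>x y. \<psi> (x, y) = eval f [x, y])"

definition re_rel :: "nat rel \<Rightarrow> bool" where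
  "re_rel R \<longleftrightarrow> (\<exists>\<psi>. partial_recursive2 \<psi> \<and> R = dom \<psi>)"

definition semi_re :: "nat set \<Rightarrow> bool" where
  "semi_re M \<longleftrightarrow>
    (\<exists>\<psi>. partial_recursive2 \<psi> \<and>
      (\<forall>x y. x \<in> M \<or> y \<in> M \<longrightarrow> (\<exists>z. \<psi> (x, y) = Some z \<and> z \<in> {x, y} \<inter> M)))"

text \<open>A pair \<open>(x, y) \<in> R\<close> is read as \<open>x\<close> being below \<open>y\<close>.\<close>

definition initial_segment :: "nat set \<Rightarrow> nat rel \<Rightarrow> bool" where
  "initial_segment M R \<longleftrightarrow> (\<forall>x\<in>M. \<forall>y\<in>UNIV - M. (x, y) \<in> R \<and> (y, x) \<notin> R)"

end

theory Submission
  imports Defs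
begin

text \<open>
  Given a selector \<open>\<psi>\<close> for \<open>M\<close>, put an edge from \<open>x\<close> to \<open>y\<close> if \<open>\<psi>\<close> selects \<open>x\<close> from \<open>x\<close> and \<open>y\<close>, in
  either order. An edge into \<open>M\<close> starts in \<open>M\<close>, hence so does every path, and the reflexive
  transitive closure of the edge relation is the required quasi-ordering. Conversely, enumerate
  the quasi-ordering until \<open>x \<preceq> y\<close> or \<open>y \<preceq> x\<close> appears, and select the smaller element.

  For the recursion-theoretic part, call a relation semidecidable if it is the projection of a
  decidable one. Semidecidable relations are closed under existential and bounded universal
  quantification. Since finite sequences can be coded by the digits of a number in a suitable
  base, they are also closed under reflexive transitive closure, and they contain the graphs of
  all partial recursive functions.
\<close>

section \<open>Total recursive functions\<close>

named_theorems computable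

text \<open>Terms carry no arity, so arity enters only through the length of the argument list;
  \<open>F\<close> may be anything on other lengths.\<close>

definition total_rec :: "nat \<Rightarrow> (nat list \<Rightarrow> nat) \<Rightarrow> bool" where
  "total_rec k F \<longleftrightarrow> (\<exists>f. \<forall>xs. length xs = k \<longrightarrow> eval f xs = Some (F xs))"

lemma total_rec_cong:
  assumes "total_rec k F" "\<And>xs. length xs = k \<Longrightarrow> F xs = G xs"
  shows "total_rec k G"
  using assms unfolding total_rec_def by auto

lemma total_rec_nth [computable]: "i < k \<Longrightarrow> total_rec k (\<lambda>xs. xs ! i)"
  unfolding total_rec_def by (rule exI[of _ "Proj i"]) simp

lemma total_rec_zero: "total_rec k (\<lambda>xs. 0)"
  unfolding total_rec_def by (rule exI[of _ Zero]) simp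

lemma total_rec_Suc [computable]:
  assumes "total_rec k F"
  shows "total_rec k (\<lambda>xs. Suc (F xs))"
proof -
  obtain f where "\<And>xs. length xs = k \<Longrightarrow> eval f xs = Some (F xs)"
    using assms by (auto simp: total_rec_def)
  then have "length xs = k \<Longrightarrow> eval (Comp Succ [f]) xs = Some (Suc (F xs))" for xs
    by simp
  then show ?thesis unfolding total_rec_def by blast
qed

lemma total_rec_const [computable]: "total_rec k (\<lambda>xs. c)"
  by (induction c) (intro total_rec_zero computable; assumption)+

lemma total_rec_comp:
  assumes F: "total_rec (length Gs) F" and Gs: "\<And>G. G \<in> set Gs \<Longrightarrow> total_rec k G"
  shows "total_rec k (\<lambda>xs. F (map (\<lambda>G. G xs) Gs))"
proof -
  obtain f where f: "\<And>xs. length xs = length Gs \<Longrightarrow> eval f xs = Some (F xs)"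
    using F by (auto simp: total_rec_def)
  from Gs have "\<forall>G\<in>set Gs. \<exists>g. \<forall>xs. length xs = k \<longrightarrow> eval g xs = Some (G xs)"
    by (simp add: total_rec_def)
  then obtain h where h: "\<And>G xs. G \<in> set Gs \<Longrightarrow> length xs = k \<Longrightarrow> eval (h G) xs = Some (G xs)"
    by metis
  have "eval (Comp f (map h Gs)) xs = Some (F (map (\<lambda>G. G xs) Gs))" if "length xs = k" for xs
  proof -
    have vals: "map (\<lambda>g. the (eval g xs)) (map h Gs) = map (\<lambda>G. G xs) Gs"
      using h that by simp
    have defined: "\<forall>g\<in>set (map h Gs). eval g xs \<noteq> None"
      using h that by simp
    show ?thesis
      unfolding eval.simps if_P[OF defined] vals by (simp add: f)
  qed
  then show ?thesis unfolding total_rec_def by blast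
qed

lemma map_nth_shift: "length xs = c + k \<Longrightarrow> map (\<lambda>j. xs ! (c + j)) [0..<k] = drop c xs"
  by (rule nth_equalityI) auto

text \<open>Insertion, deletion and permutation of arguments below use this form and its analogues
  for relations: the first \<open>c\<close> arguments are recomputed, the other \<open>k\<close> are
  kept as parameters.\<close>

lemma total_rec_subst:
  assumes "total_rec (length Gs + k) F" "\<And>G. G \<in> set Gs \<Longrightarrow> total_rec (c + k) G"
  shows "total_rec (c + k) (\<lambda>xs. F (map (\<lambda>G. G xs) Gs @ drop c xs))"
proof -
  let ?Hs = "Gs @ map (\<lambda>j xs. xs ! (c + j)) [0..<k]"
  have "total_rec (c + k) (\<lambda>xs. F (map (\<lambda>G. G xs) ?Hs))"
    by (rule total_rec_comp) (use assms in \<open>auto intro: total_rec_nth\<close>)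
  then show ?thesis
    by (rule total_rec_cong) (simp add: comp_def map_nth_shift)
qed

lemma total_rec_comp1:
  assumes "total_rec 1 (\<lambda>xs. h (xs ! 0))" "total_rec k F"
  shows "total_rec k (\<lambda>xs. h (F xs))"
  using total_rec_comp[of "[F]" "\<lambda>xs. h (xs ! 0)" k] assms by simp

lemma total_rec_comp2:
  assumes "total_rec 2 (\<lambda>xs. h (xs ! 0) (xs ! 1))" "total_rec k F" "total_rec k G"
  shows "total_rec k (\<lambda>xs. h (F xs) (G xs))"
  using total_rec_comp[of "[F, G]" "\<lambda>xs. h (xs ! 0) (xs ! 1)" k] assms
  by (auto simp: numeral_2_eq_2)

lemma total_rec_prec:
  assumes F: "total_rec k F" and G: "total_rec (Suc (Suc k)) G"
  shows "total_rec (Suc k) (\<lambda>xs. rec_nat (F (tl xs)) (\<lambda>m v. G (m # v # tl xs)) (hd xs))"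
proof -
  obtain f g where f: "\<And>xs. length xs = k \<Longrightarrow> eval f xs = Some (F xs)"
    and g: "\<And>xs. length xs = Suc (Suc k) \<Longrightarrow> eval g xs = Some (G xs)"
    using F G by (auto simp: total_rec_def)
  have "eval (Prec f g) (n # ys) = Some (rec_nat (F ys) (\<lambda>m v. G (m # v # ys)) n)"
    if "length ys = k" for n ys
    using that by (induction n) (auto simp: f g)
  then show ?thesis
    unfolding total_rec_def by (auto simp: length_Suc_conv intro!: exI[of _ "Prec f g"])
qed

section \<open>Arithmetic operations by primitive recursion\<close>

lemma total_rec_add [computable]:
  assumes "total_rec k F" "total_rec k G"
  shows "total_rec k (\<lambda>xs. F xs + G xs)"
proof (rule total_rec_comp2[OF _ assms])
  have eq: "rec_nat y (\<lambda>m v. Suc v) n = n + y" for n y :: nat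
    by (induction n) auto
  have "total_rec (Suc 1) (\<lambda>xs. rec_nat (tl xs ! 0) (\<lambda>m v. Suc ((m # v # tl xs) ! 1)) (hd xs))"
    by (intro total_rec_prec) (simp?; intro computable; simp)+
  then show "total_rec 2 (\<lambda>xs. xs ! 0 + xs ! 1)"
    unfolding numeral_2_eq_2 One_nat_def
    by (rule total_rec_cong) (auto simp: length_Suc_conv eq)
qed

lemma total_rec_mult [computable]:
  assumes "total_rec k F" "total_rec k G"
  shows "total_rec k (\<lambda>xs. F xs * G xs)"
proof (rule total_rec_comp2[OF _ assms])
  have eq: "rec_nat 0 (\<lambda>m v. v + y) n = n * y" for n y :: nat
    by (induction n) auto
  have "total_rec (Suc 1)
    (\<lambda>xs. rec_nat 0 (\<lambda>m v. (m # v # tl xs) ! 1 + (m # v # tl xs) ! 2) (hd xs))"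
    by (intro total_rec_prec) (simp?; intro computable; simp)+
  then show "total_rec 2 (\<lambda>xs. xs ! 0 * xs ! 1)"
    unfolding numeral_2_eq_2 One_nat_def
    by (rule total_rec_cong) (auto simp: length_Suc_conv eq)
qed

lemma total_rec_power [computable]:
  assumes "total_rec k F" "total_rec k G"
  shows "total_rec k (\<lambda>xs. F xs ^ G xs)"
\<comment> \<open>Recursion runs on the first argument, so the exponent is moved in front of the
  base.\<close>
proof (rule total_rec_comp2[OF _ assms(2,1), of "\<lambda>n b. b ^ n"])
  have eq: "rec_nat 1 (\<lambda>m v. v * y) n = y ^ n" for n y :: nat
    by (induction n) auto
  have "total_rec (Suc 1)
    (\<lambda>xs. rec_nat 1 (\<lambda>m v. (m # v # tl xs) ! 1 * (m # v # tl xs) ! 2) (hd xs))"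
    by (intro total_rec_prec) (simp?; intro computable; simp)+
  then show "total_rec 2 (\<lambda>xs. xs ! 1 ^ xs ! 0)"
    unfolding numeral_2_eq_2 One_nat_def
    by (rule total_rec_cong) (auto simp: length_Suc_conv eq[simplified])
qed

lemma total_rec_diff [computable]:
  assumes "total_rec k F" "total_rec k G"
  shows "total_rec k (\<lambda>xs. F xs - G xs)"
proof (rule total_rec_comp2[OF _ assms(2,1), of "\<lambda>n y. y - n"])
  \<comment> \<open>Predecessor: the recursion step ignores the previous value and returns its
    index.\<close>
  have "total_rec (Suc 0) (\<lambda>xs. rec_nat 0 (\<lambda>m v. (m # v # tl xs) ! 0) (hd xs))"
    by (intro total_rec_prec) (simp?; intro computable; simp)+
  then have "total_rec 1 (\<lambda>xs. xs ! 0 - 1)"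
    unfolding One_nat_def
    by (rule total_rec_cong) (auto simp: length_Suc_conv split: nat.splits, case_tac y, auto)
  then have pred: "total_rec k F \<Longrightarrow> total_rec k (\<lambda>xs. F xs - 1)" for k F
    by (rule total_rec_comp1[of "\<lambda>x. x - 1"])
  have eq: "rec_nat y (\<lambda>m v. v - 1) n = y - n" for n y :: nat
    by (induction n) auto
  have "total_rec (Suc 1) (\<lambda>xs. rec_nat (tl xs ! 0) (\<lambda>m v. (m # v # tl xs) ! 1 - 1) (hd xs))"
    by (rule total_rec_prec) (simp; intro computable pred[simplified]; simp)+
  then show "total_rec 2 (\<lambda>xs. xs ! 1 - xs ! 0)"
    unfolding numeral_2_eq_2 One_nat_def
    by (rule total_rec_cong) (auto simp: length_Suc_conv eq[simplified])
qed


section \<open>Decidable relations\<close>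

text \<open>Truth is coded by \<open>0\<close>, as minimisation searches for zeros.\<close>

definition decidable :: "nat \<Rightarrow> (nat list \<Rightarrow> bool) \<Rightarrow> bool" where
  "decidable k P \<longleftrightarrow> total_rec k (\<lambda>xs. if P xs then 0 else 1)"

lemma decidable_cong:
  assumes "decidable k P" "\<And>xs. length xs = k \<Longrightarrow> P xs \<longleftrightarrow> Q xs"
  shows "decidable k Q"
  using assms(1) unfolding decidable_def by (rule total_rec_cong) (simp add: assms(2))

lemma decidable_eq_zero:
  assumes "total_rec k F"
  shows "decidable k (\<lambda>xs. F xs = 0)"
proof -
  \<comment> \<open>Truncated subtraction applied twice sends every nonzero value to
    \<open>1\<close>.\<close>
  have "total_rec k (\<lambda>xs. 1 - (1 - F xs))"
    by (intro computable assms)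
  then show ?thesis
    unfolding decidable_def by (rule total_rec_cong) auto
qed

lemma decidable_le [computable]:
  assumes "total_rec k F" "total_rec k G"
  shows "decidable k (\<lambda>xs. F xs \<le> G xs)"
  by (rule decidable_cong[OF decidable_eq_zero[of _ "\<lambda>xs. F xs - G xs"]]) (intro computable assms, auto)

lemma decidable_less [computable]:
  assumes "total_rec k F" "total_rec k G"
  shows "decidable k (\<lambda>xs. F xs < G xs)"
  unfolding Suc_le_eq[symmetric] by (intro computable assms)

lemma decidable_disj [computable]:
  assumes "decidable k P" "decidable k Q"
  shows "decidable k (\<lambda>xs. P xs \<or> Q xs)"
proof -
  \<comment> \<open>With \<open>0\<close> for truth, a product of truth values expresses
    disjunction.\<close>
  have "decidable k (\<lambda>xs. (if P xs then 0 else 1) * (if Q xs then 0 else 1) = (0::nat))"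
    using assms unfolding decidable_def[of _ P] decidable_def[of _ Q]
    by (intro decidable_eq_zero computable)
  then show ?thesis
    by (rule decidable_cong) auto
qed

lemma decidable_not [computable]:
  assumes "decidable k P"
  shows "decidable k (\<lambda>xs. \<not> P xs)"
proof -
  have "decidable k (\<lambda>xs. 1 - (if P xs then 0 else 1) = (0::nat))"
    using assms unfolding decidable_def[of _ P] by (intro decidable_eq_zero computable)
  then show ?thesis
    by (rule decidable_cong) auto
qed

lemma decidable_conj [computable]:
  assumes "decidable k P" "decidable k Q"
  shows "decidable k (\<lambda>xs. P xs \<and> Q xs)"
  by (rule decidable_cong[of _ "\<lambda>xs. \<not> (\<not> P xs \<or> \<not> Q xs)"]) (intro computable assms, blast)

lemma decidable_eq [computable]:
  assumes "total_rec k F" "total_rec k G"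
  shows "decidable k (\<lambda>xs. F xs = G xs)"
  unfolding eq_iff by (intro computable assms)

lemma total_rec_If:
  assumes "decidable k P" "total_rec k F" "total_rec k G"
  shows "total_rec k (\<lambda>xs. if P xs then F xs else G xs)"
proof -
  \<comment> \<open>Each branch is multiplied by a factor that is \<open>1\<close> if the branch is
    selected and \<open>0\<close> otherwise.\<close>
  have "total_rec k (\<lambda>xs. (1 - (if P xs then 0 else 1)) * F xs + (if P xs then 0 else 1) * G xs)"
    using assms unfolding decidable_def by (intro computable)
  then show ?thesis
    by (rule total_rec_cong) auto
qed

lemma decidable_subst:
  assumes "decidable (length Gs + k) P" "\<And>G. G \<in> set Gs \<Longrightarrow> total_rec (c + k) G"
  shows "decidable (c + k) (\<lambda>xs. P (map (\<lambda>G. G xs) Gs @ drop c xs))"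
  using assms unfolding decidable_def by (rule total_rec_subst)

section \<open>Minimisation, bounded quantifiers and division\<close>

lemma total_rec_Least:
  assumes "decidable (Suc k) P" and ex: "\<And>xs. length xs = k \<Longrightarrow> \<exists>n. P (n # xs)"
  shows "total_rec k (\<lambda>xs. LEAST n. P (n # xs))"
proof -
  obtain f where f: "\<And>xs. length xs = Suc k \<Longrightarrow> eval f xs = Some (if P xs then 0 else 1)"
    using assms(1) by (auto simp: decidable_def total_rec_def)
  have "eval (Mu f) xs = Some (LEAST n. P (n # xs))" if "length xs = k" for xs
    using ex[OF that] that by (auto simp: f)
  then show ?thesis unfolding total_rec_def by blast
qed

text \<open>The search for the first \<open>n\<close> that satisfies \<open>P\<close> or reaches the
  bound always stops; there is a witness below the bound iff it stops before the bound.\<close>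

lemma decidable_bex:
  assumes "decidable (Suc k) P" "total_rec k N"
  shows "decidable k (\<lambda>xs. \<exists>i<N xs. P (i # xs))"
proof -
  let ?Q = "\<lambda>xs. P xs \<or> N (tl xs) \<le> hd xs"
  have "total_rec (Suc k) (\<lambda>xs. N (tl xs))"
    using total_rec_subst[of "[]" k N 1] assms(2) by (simp add: drop_Suc)
  moreover have "total_rec (Suc k) hd"
    by (rule total_rec_cong[OF total_rec_nth[of 0]]) (auto simp: length_Suc_conv)
  ultimately have "decidable (Suc k) ?Q"
    by (intro computable assms(1))
  then have "total_rec k (\<lambda>xs. LEAST n. ?Q (n # xs))"
    by (rule total_rec_Least) auto
  then have "decidable k (\<lambda>xs. (LEAST n. ?Q (n # xs)) < N xs)"
    by (intro computable assms(2))
  then show ?thesis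
  proof (rule decidable_cong)
    fix xs
    let ?n = "LEAST n. ?Q (n # xs)"
    have "?Q (?n # xs)"
      by (rule LeastI[of "\<lambda>n. ?Q (n # xs)" "N xs"]) simp
    moreover have "?n \<le> i" if "P (i # xs)" for i
      using that by (simp add: Least_le)
    ultimately show "?n < N xs \<longleftrightarrow> (\<exists>i<N xs. P (i # xs))"
      by (auto intro: le_less_trans)
  qed
qed

lemma decidable_ball:
  assumes "decidable (Suc k) P" "total_rec k N"
  shows "decidable k (\<lambda>xs. \<forall>i<N xs. P (i # xs))"
  by (rule decidable_cong[OF decidable_not[OF decidable_bex[of _ "\<lambda>xs. \<not> P xs"]]])
    (intro decidable_not assms, auto intro: assms)

lemma total_rec_div [computable]:
  assumes "total_rec k F" "total_rec k G"
  shows "total_rec k (\<lambda>xs. F xs div G xs)"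
proof (rule total_rec_comp2[OF _ assms])
  have ex: "x < y * Suc (x div y)" if "y \<noteq> 0" for x y :: nat
    using that dividend_less_times_div[of y x] by simp
  \<comment> \<open>The quotient is found by minimisation. The disjunct \<open>y = 0\<close> stops
    the search at once for a zero divisor and yields \<open>0\<close>, the value of
    \<open>x div 0\<close>.\<close>
  have eq: "(LEAST q. y = 0 \<or> x < y * Suc q) = x div y" for x y :: nat
  proof (cases "y = 0")
    case False
    show ?thesis
    proof (rule Least_equality)
      show "y = 0 \<or> x < y * Suc (x div y)"
        using ex[OF False] by simp
    next
      fix q assume "y = 0 \<or> x < y * Suc q"
      then show "x div y \<le> q"
        using False by (metis div_less_iff_less_mult less_Suc_eq_le mult.commute neq0_conv)
    qed
  qed simp
  have "total_rec 2 (\<lambda>xs. LEAST q. (q # xs) ! 2 = 0 \<or>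
      (q # xs) ! 1 < (q # xs) ! 2 * Suc ((q # xs) ! 0))"
  proof (rule total_rec_Least)
    fix xs :: "nat list"
    show "\<exists>q. (q # xs) ! 2 = 0 \<or> (q # xs) ! 1 < (q # xs) ! 2 * Suc ((q # xs) ! 0)"
      by simp (metis ex mult_Suc_right)
  qed (intro computable; simp)
  then show "total_rec 2 (\<lambda>xs. xs ! 0 div xs ! 1)"
    by (rule total_rec_cong) (simp add: eq[simplified])
qed

lemma total_rec_mod [computable]:
  assumes "total_rec k F" "total_rec k G"
  shows "total_rec k (\<lambda>xs. F xs mod G xs)"
  unfolding minus_mult_div_eq_mod[symmetric] by (intro computable assms)


section \<open>Semidecidable relations\<close>

text \<open>The witness is the head of the list, the position over which minimisation
  searches.\<close>

definition semidecidable :: "nat \<Rightarrow> (nat list \<Rightarrow> bool) \<Rightarrow> bool" where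
  "semidecidable k P \<longleftrightarrow>
    (\<exists>D. decidable (Suc k) D \<and> (\<forall>xs. length xs = k \<longrightarrow> P xs \<longleftrightarrow> (\<exists>t. D (t # xs))))"

lemma semidecidableE:
  assumes "semidecidable k P"
  obtains D where "decidable (Suc k) D" "\<And>xs. length xs = k \<Longrightarrow> P xs \<longleftrightarrow> (\<exists>t. D (t # xs))"
  using assms unfolding semidecidable_def by blast

lemma semidecidable_cong:
  assumes "semidecidable k P" "\<And>xs. length xs = k \<Longrightarrow> P xs \<longleftrightarrow> Q xs"
  shows "semidecidable k Q"
  using assms unfolding semidecidable_def by auto

lemma semidecidable_decidable:
  assumes "decidable k P"
  shows "semidecidable k P"
proof -
  have "decidable (Suc k) (\<lambda>xs. P (drop 1 xs))"
    using decidable_subst[of "[]" k P 1] assms by simp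
  then show ?thesis
    unfolding semidecidable_def by (intro exI[of _ "\<lambda>xs. P (drop 1 xs)"]) simp
qed

lemma semidecidable_subst:
  assumes P: "semidecidable (length Gs + k) P"
    and Gs: "\<And>G. G \<in> set Gs \<Longrightarrow> total_rec (c + k) G"
  shows "semidecidable (c + k) (\<lambda>xs. P (map (\<lambda>G. G xs) Gs @ drop c xs))"
proof -
  obtain D where D: "decidable (Suc (length Gs + k)) D"
    and P_eq: "\<And>xs. length xs = length Gs + k \<Longrightarrow> P xs \<longleftrightarrow> (\<exists>t. D (t # xs))"
    using P by (rule semidecidableE) blast
  \<comment> \<open>The witness stays in front, and \<open>drop 1\<close> makes each
    \<open>G\<close> skip it.\<close>
  let ?Hs = "(\<lambda>xs. xs ! 0) # map (\<lambda>G xs. G (drop 1 xs)) Gs"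
  have "total_rec (Suc (c + k)) (\<lambda>xs. G (drop 1 xs))" if "G \<in> set Gs" for G
    using total_rec_subst[of "[]" "c + k" G 1] Gs[OF that] by simp
  then have "decidable (Suc c + k) (\<lambda>xs. D (map (\<lambda>H. H xs) ?Hs @ drop (Suc c) xs))"
    by (intro decidable_subst) (use D in \<open>auto intro!: computable\<close>)
  then show ?thesis
    unfolding semidecidable_def
    by (intro exI[of _ "\<lambda>xs. D (map (\<lambda>H. H xs) ?Hs @ drop (Suc c) xs)"])
      (auto simp: P_eq comp_def)
qed

text \<open>One number \<open>w\<close> bounding both \<open>y\<close> and its witness
  \<open>t\<close> replaces the two unbounded quantifiers; the search below \<open>w\<close> is
  decidable. This avoids a pairing function.\<close>

lemma semidecidable_ex:
  assumes "semidecidable (Suc k) P"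
  shows "semidecidable k (\<lambda>xs. \<exists>y. P (y # xs))"
proof -
  obtain D where D: "decidable (Suc (Suc k)) D"
    and P_eq: "\<And>xs. length xs = Suc k \<Longrightarrow> P xs \<longleftrightarrow> (\<exists>t. D (t # xs))"
    using assms by (rule semidecidableE) blast
  \<comment> \<open>The list is \<open>t # y # w # xs\<close>; \<open>D\<close> receives it without
    the bound \<open>w\<close>.\<close>
  let ?E = "\<lambda>xs. D (map (\<lambda>G. G xs) [\<lambda>xs. xs ! 0, \<lambda>xs. xs ! 1] @ drop 3 xs)"
  let ?B = "\<lambda>xs. \<exists>y<xs ! 0. \<exists>t<(y # xs) ! 1. ?E (t # y # xs)"
  have "decidable (3 + k) ?E"
    by (rule decidable_subst) (use D in \<open>auto intro!: computable\<close>)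
  then have "decidable (Suc k) ?B"
    by (intro decidable_bex) (auto simp: numeral_3_eq_3 intro!: computable)
  moreover have "(\<exists>y. P (y # xs)) \<longleftrightarrow> (\<exists>w. ?B (w # xs))" if "length xs = k" for xs
  proof -
    have "\<exists>w. y < w \<and> t < w" for y t :: nat
      by (rule exI[of _ "Suc (max y t)"]) auto
    then show ?thesis
      using that by (simp add: P_eq) meson
  qed
  ultimately show ?thesis
    unfolding semidecidable_def by blast
qed

text \<open>Finitely many instances have finitely many chosen witnesses, so a single
  \<open>w\<close> bounds them all and leaves only bounded quantifiers inside.\<close>

lemma semidecidable_ball:
  assumes "semidecidable (Suc k) P" and N: "total_rec k N"
  shows "semidecidable k (\<lambda>xs. \<forall>i<N xs. P (i # xs))"
proof -
  obtain D where D: "decidable (Suc (Suc k)) D"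
    and P_eq: "\<And>xs. length xs = Suc k \<Longrightarrow> P xs \<longleftrightarrow> (\<exists>t. D (t # xs))"
    using assms(1) by (rule semidecidableE) blast
  let ?E = "\<lambda>xs. D (map (\<lambda>G. G xs) [\<lambda>xs. xs ! 0, \<lambda>xs. xs ! 1] @ drop 3 xs)"
  let ?B = "\<lambda>xs. \<forall>i<N (drop 1 xs). \<exists>t<(i # xs) ! 1. ?E (t # i # xs)"
  have "decidable (3 + k) ?E"
    by (rule decidable_subst) (use D in \<open>auto intro!: computable\<close>)
  moreover have "total_rec (Suc k) (\<lambda>xs. N (drop 1 xs))"
    using total_rec_subst[of "[]" k N 1] N by simp
  ultimately have "decidable (Suc k) ?B"
    by (intro decidable_ball decidable_bex) (auto simp: numeral_3_eq_3 intro!: computable)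
  moreover have "(\<forall>i<N xs. P (i # xs)) \<longleftrightarrow> (\<exists>w. ?B (w # xs))" if "length xs = k" for xs
  proof -
    have "\<exists>w. \<forall>i<n. \<exists>t<w. D (t # i # xs)" if "\<forall>i<n. \<exists>t. D (t # i # xs)" for n
      using that
    proof (induction n)
      case (Suc n)
      then obtain w t where "\<forall>i<n. \<exists>t<w. D (t # i # xs)" "D (t # n # xs)"
        by (metis less_Suc_eq)
      then show ?case
        by (intro exI[of _ "Suc (max w t)"]) (metis less_Suc_eq less_Suc_eq_le max.cobounded2
            less_max_iff_disj)
    qed simp
    then show ?thesis
      using that by (simp add: P_eq) blast
  qed
  ultimately show ?thesis
    unfolding semidecidable_def by blast
qed

text \<open>Each conjunct gets a witness of its own in front of the list; both are then quantified
  away by \<open>semidecidable_ex\<close>.\<close>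

lemma semidecidable_conj:
  assumes "semidecidable k P" "semidecidable k Q"
  shows "semidecidable k (\<lambda>xs. P xs \<and> Q xs)"
proof -
  obtain D where D: "decidable (Suc k) D"
    and P_eq: "\<And>xs. length xs = k \<Longrightarrow> P xs \<longleftrightarrow> (\<exists>t. D (t # xs))"
    using assms(1) by (rule semidecidableE) blast
  obtain E where E: "decidable (Suc k) E"
    and Q_eq: "\<And>xs. length xs = k \<Longrightarrow> Q xs \<longleftrightarrow> (\<exists>t. E (t # xs))"
    using assms(2) by (rule semidecidableE) blast
  have "decidable (2 + k) (\<lambda>xs. D (map (\<lambda>G. G xs) [\<lambda>xs. xs ! 0] @ drop 2 xs) \<and>
      E (map (\<lambda>G. G xs) [\<lambda>xs. xs ! 1] @ drop 2 xs))"
    by (intro decidable_conj decidable_subst) (use D E in \<open>auto intro!: computable\<close>)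
  then have "semidecidable (Suc (Suc k)) (\<lambda>xs. D (xs ! 0 # drop 2 xs) \<and> E (xs ! 1 # drop 2 xs))"
    by (simp add: semidecidable_decidable)
  from this[THEN semidecidable_ex, THEN semidecidable_ex] show ?thesis
    by (rule semidecidable_cong) (simp add: P_eq Q_eq)
qed

text \<open>One witness suffices, as the existential quantifier distributes over
  disjunction.\<close>

lemma semidecidable_disj:
  assumes "semidecidable k P" "semidecidable k Q"
  shows "semidecidable k (\<lambda>xs. P xs \<or> Q xs)"
proof -
  obtain D where D: "decidable (Suc k) D"
    and P_eq: "\<And>xs. length xs = k \<Longrightarrow> P xs \<longleftrightarrow> (\<exists>t. D (t # xs))"
    using assms(1) by (rule semidecidableE) blast
  obtain E where E: "decidable (Suc k) E"
    and Q_eq: "\<And>xs. length xs = k \<Longrightarrow> Q xs \<longleftrightarrow> (\<exists>t. E (t # xs))"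
    using assms(2) by (rule semidecidableE) blast
  have "decidable (Suc k) (\<lambda>xs. D xs \<or> E xs)"
    using D E by (intro computable)
  then show ?thesis
    unfolding semidecidable_def
    by (intro exI[of _ "\<lambda>xs. D xs \<or> E xs"]) (auto simp: P_eq Q_eq)
qed


section \<open>Coding of sequences\<close>

text \<open>Digits are counted from the least significant one. As powers are recursive, this coding
  needs no Chinese remainder theorem.\<close>

definition digit :: "nat \<Rightarrow> nat \<Rightarrow> nat \<Rightarrow> nat" where
  "digit b c i = c div b ^ i mod b"

lemma total_rec_digit [computable]:
  assumes "total_rec k B" "total_rec k C" "total_rec k I"
  shows "total_rec k (\<lambda>xs. digit (B xs) (C xs) (I xs))"
  unfolding digit_def by (intro computable assms)

text \<open>Horner's scheme: the induction puts a new lowest digit in front of a code for the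
  shifted sequence.\<close>

lemma ex_digits_base:
  assumes "\<And>i. i \<le> n \<Longrightarrow> a i < b"
  shows "\<exists>c. \<forall>i\<le>n. digit b c i = a i"
  using assms
proof (induction n arbitrary: a)
  case 0
  then show ?case
    by (intro exI[of _ "a 0"]) (simp add: digit_def)
next
  case (Suc n)
  obtain c where c: "\<forall>i\<le>n. digit b c i = a (Suc i)"
    using Suc.IH[of "\<lambda>i. a (Suc i)"] Suc.prems by auto
  have a0: "a 0 < b"
    using Suc.prems by simp
  then have "digit b (a 0 + b * c) (Suc i) = digit b c i" for i
    by (simp add: digit_def div_mult2_eq)
  moreover have "digit b (a 0 + b * c) 0 = a 0"
    using a0 by (simp add: digit_def)
  ultimately have "digit b (a 0 + b * c) i = a i" if "i \<le> Suc n" for i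
    using that c by (cases i) auto
  then show ?case by blast
qed

lemma ex_digits: "\<exists>b c. \<forall>i\<le>n. digit b c i = a i"
proof -
  have "a i < Suc (Max (a ` {..n}))" if "i \<le> n" for i
    using that by (simp add: less_Suc_eq_le)
  from ex_digits_base[of n a, OF this] show ?thesis by blast
qed

section \<open>Reflexive transitive closure\<close>

lemma rtranclp_iff_path:
  "E\<^sup>*\<^sup>* x y \<longleftrightarrow> (\<exists>n a. a 0 = x \<and> a n = y \<and> (\<forall>i<n. E (a i) (a (Suc i))))"
  by (simp add: rtranclp_power relpowp_fun_conv)

text \<open>A path is given by its length \<open>n\<close> and by the digits of \<open>c\<close> in
  base \<open>b\<close>, so only three existential quantifiers and one bounded universal quantifier
  are added.\<close>

lemma semidecidable_rtranclp:
  assumes "semidecidable 2 (\<lambda>xs. E (xs ! 0) (xs ! 1))"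
  shows "semidecidable 2 (\<lambda>xs. E\<^sup>*\<^sup>* (xs ! 0) (xs ! 1))"
proof -
  \<comment> \<open>The argument order is \<open>c # b # n # x # y\<close>, with the index
    \<open>i\<close> in front of it inside the bounded quantifier.\<close>
  let ?d = "\<lambda>xs i. digit (xs ! 1) (xs ! 0) i"
  let ?G = "[\<lambda>xs. digit (xs ! 2) (xs ! 1) (xs ! 0), \<lambda>xs. digit (xs ! 2) (xs ! 1) (Suc (xs ! 0))]"
  let ?E = "\<lambda>xs. E (xs ! 0) (xs ! 1)"
  have "semidecidable (6 + 0) (\<lambda>xs. ?E (map (\<lambda>G. G xs) ?G @ drop 6 xs))"
    by (rule semidecidable_subst) (use assms in \<open>auto simp: numeral_2_eq_2 intro!: computable\<close>)
  then have "semidecidable 5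
      (\<lambda>xs. \<forall>i<xs ! 2. ?E (map (\<lambda>G. G (i # xs)) ?G @ drop 6 (i # xs)))"
    by (intro semidecidable_ball) (auto intro: total_rec_nth)
  moreover have "semidecidable 5 (\<lambda>xs. ?d xs 0 = xs ! 3 \<and> ?d xs (xs ! 2) = xs ! 4)"
    by (intro semidecidable_decidable computable) auto
  ultimately have "semidecidable 5
      (\<lambda>xs. (?d xs 0 = xs ! 3 \<and> ?d xs (xs ! 2) = xs ! 4) \<and>
        (\<forall>i<xs ! 2. E (?d xs i) (?d xs (Suc i))))"
    by (simp add: semidecidable_conj flip: conj_assoc)
  then have "semidecidable (Suc (Suc (Suc 2)))
      (\<lambda>xs. (?d xs 0 = xs ! 3 \<and> ?d xs (xs ! 2) = xs ! 4) \<and>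
        (\<forall>i<xs ! 2. E (?d xs i) (?d xs (Suc i))))"
    by simp
  from this[THEN semidecidable_ex, THEN semidecidable_ex, THEN semidecidable_ex]
  show ?thesis
  proof (rule semidecidable_cong)
    fix xs :: "nat list"
    have "(\<exists>n b c. (digit b c 0 = x \<and> digit b c n = y) \<and>
        (\<forall>i<n. E (digit b c i) (digit b c (Suc i)))) \<longleftrightarrow> E\<^sup>*\<^sup>* x y" for x y
    proof
      assume "E\<^sup>*\<^sup>* x y"
      then obtain n a where a: "a 0 = x" "a n = y" "\<forall>i<n. E (a i) (a (Suc i))"
        unfolding rtranclp_iff_path by blast
      obtain b c where "\<forall>i\<le>n. digit b c i = a i"
        using ex_digits by blast
      then show "\<exists>n b c. (digit b c 0 = x \<and> digit b c n = y) \<and>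
          (\<forall>i<n. E (digit b c i) (digit b c (Suc i)))"
        using a by (intro exI[of _ n] exI[of _ b] exI[of _ c]) auto
    qed (auto simp: rtranclp_iff_path)
    then show "(\<exists>n b c. (?d (c # b # n # xs) 0 = (c # b # n # xs) ! 3 \<and>
          ?d (c # b # n # xs) ((c # b # n # xs) ! 2) = (c # b # n # xs) ! 4) \<and>
        (\<forall>i<(c # b # n # xs) ! 2. E (?d (c # b # n # xs) i) (?d (c # b # n # xs) (Suc i))))
      \<longleftrightarrow> E\<^sup>*\<^sup>* (xs ! 0) (xs ! 1)"
      by simp
  qed
qed


section \<open>Graphs of partial recursive functions\<close>

text \<open>The sequence \<open>a\<close> of intermediate values unfolds the recursion into a form
  to which digit coding applies.\<close>

lemma eval_Prec_eq_Some_iff: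
  "eval (Prec f g) (n # ys) = Some v \<longleftrightarrow>
    (\<exists>a. eval f ys = Some (a 0) \<and> (\<forall>i<n. eval g (i # a i # ys) = Some (a (Suc i))) \<and> a n = v)"
proof
  let ?r = "rec_nat (eval f ys) (\<lambda>m r. Option.bind r (\<lambda>v. eval g (m # v # ys)))"
  {
    assume v: "eval (Prec f g) (n # ys) = Some v"
    \<comment> \<open>\<open>Option.bind\<close> propagates undefinedness upwards, so definedness at
      \<open>n\<close> descends to all earlier stages.\<close>
    have def: "?r i \<noteq> None" if "i \<le> n" for i
      using that by (induction rule: inc_induct) (use v in \<open>auto simp: bind_eq_None_conv\<close>)
    have "eval g (i # the (?r i) # ys) = Some (the (?r (Suc i)))" if "i < n" for i
      using def[of i] def[of "Suc i"] that by auto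
    moreover have "eval f ys = Some (the (?r 0))"
      using def[of 0] by simp
    ultimately show "\<exists>a. eval f ys = Some (a 0) \<and>
        (\<forall>i<n. eval g (i # a i # ys) = Some (a (Suc i))) \<and> a n = v"
      using v by (intro exI[of _ "\<lambda>i. the (?r i)"]) simp
  }
  assume "\<exists>a. eval f ys = Some (a 0) \<and>
    (\<forall>i<n. eval g (i # a i # ys) = Some (a (Suc i))) \<and> a n = v"
  then obtain a where a: "eval f ys = Some (a 0)" "a n = v"
    "\<And>i. i < n \<Longrightarrow> eval g (i # a i # ys) = Some (a (Suc i))"
    by blast
  have "?r i = Some (a i)" if "i \<le> n" for i
    using that by (induction i) (use a in auto)
  then show "eval (Prec f g) (n # ys) = Some v"
    using a(2) by simp
qed

text \<open>A value of the form \<open>Suc v\<close> excludes both \<open>None\<close> and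
  \<open>Some 0\<close>: this is a positive condition on the graph of \<open>f\<close>, hence
  semidecidable when that graph is.\<close>

lemma eval_Mu_eq_Some_iff:
  "eval (Mu f) xs = Some n \<longleftrightarrow>
    eval f (n # xs) = Some 0 \<and> (\<forall>m<n. \<exists>v. eval f (m # xs) = Some (Suc v))"
proof
  let ?Z = "\<lambda>n. eval f (n # xs) = Some 0"
  {
    assume "eval (Mu f) xs = Some n"
    \<comment> \<open>\<open>k\<close> is some zero with defined values before it, while
      \<open>eval\<close> returns the least zero \<open>n\<close>; \<open>n \<le> k\<close>
      transfers the definedness.\<close>
    then obtain k where k: "?Z k" "\<forall>m<k. eval f (m # xs) \<noteq> None" and n: "n = (LEAST n. ?Z n)"
      by (auto split: if_splits)
    have "n \<le> k" "?Z n"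
      unfolding n using k(1) by (auto intro: Least_le LeastI)
    moreover have "\<exists>v. eval f (m # xs) = Some (Suc v)" if "m < n" for m
    proof -
      have "eval f (m # xs) \<noteq> Some 0"
        using that not_less_Least[of m ?Z] n by blast
      moreover have "eval f (m # xs) \<noteq> None"
        using that k(2) \<open>n \<le> k\<close> by simp
      ultimately show ?thesis
        by (metis not0_implies_Suc not_None_eq)
    qed
    ultimately show "?Z n \<and> (\<forall>m<n. \<exists>v. eval f (m # xs) = Some (Suc v))"
      by blast
  }
  assume n: "?Z n \<and> (\<forall>m<n. \<exists>v. eval f (m # xs) = Some (Suc v))"
  then have "(LEAST n. ?Z n) = n"
    by (intro Least_equality) (auto simp: not_less[symmetric])
  moreover have "\<exists>n. ?Z n \<and> (\<forall>m<n. eval f (m # xs) \<noteq> None)"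
    using n by (intro exI[of _ n]) auto
  ultimately show "eval (Mu f) xs = Some n"
    by simp
qed

text \<open>Quantifying over the list of intermediate values turns strict evaluation into a
  condition on graphs.\<close>

lemma eval_Comp_eq_Some_iff:
  "eval (Comp f gs) xs = Some v \<longleftrightarrow>
    (\<exists>ys. list_all2 (\<lambda>g y. eval g xs = Some y) gs ys \<and> eval f ys = Some v)"
proof
  assume "eval (Comp f gs) xs = Some v"
  then show "\<exists>ys. list_all2 (\<lambda>g y. eval g xs = Some y) gs ys \<and> eval f ys = Some v"
    by (intro exI[of _ "map (\<lambda>g. the (eval g xs)) gs"])
      (auto simp: list_all2_conv_all_nth split: if_splits)
next
  assume "\<exists>ys. list_all2 (\<lambda>g y. eval g xs = Some y) gs ys \<and> eval f ys = Some v"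
  then obtain ys where ys: "list_all2 (\<lambda>g y. eval g xs = Some y) gs ys" "eval f ys = Some v"
    by blast
  from ys(1) have "map (\<lambda>g. the (eval g xs)) gs = ys \<and> (\<forall>g\<in>set gs. eval g xs \<noteq> None)"
    by (induction gs ys rule: list_all2_induct) auto
  then show "eval (Comp f gs) xs = Some v"
    using ys(2) by simp
qed

text \<open>The values of \<open>gs\<close> are guessed one by one and pushed onto the argument list, so they end up
  in reverse order.\<close>

lemma semidecidable_ex_list_all2:
  assumes "\<And>g. g \<in> set gs \<Longrightarrow> semidecidable (Suc k) (\<lambda>xs. eval g (tl xs) = Some (hd xs))"
    and "semidecidable (length gs + (m + k)) Q"
  shows "semidecidable (m + k)
    (\<lambda>zs. \<exists>ys. list_all2 (\<lambda>g y. eval g (drop m zs) = Some y) gs ys \<and> Q (rev ys @ zs))"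
  using assms
proof (induction gs arbitrary: m)
  case Nil
  then show ?case by simp
next
  case (Cons g gs)
  let ?g = "\<lambda>xs. eval g (tl xs) = Some (hd xs)"
  \<comment> \<open>Once a value for \<open>g\<close> has been pushed, \<open>Suc m\<close> entries
    precede the original arguments; hence \<open>m\<close> is arbitrary in the induction.\<close>
  have "semidecidable (Suc m + k) (\<lambda>xs. ?g (map (\<lambda>G. G xs) [\<lambda>xs. xs ! 0] @ drop (Suc m) xs))"
    by (rule semidecidable_subst) (use Cons.prems(1) in \<open>auto intro!: computable\<close>)
  moreover have "semidecidable (Suc m + k)
    (\<lambda>zs. \<exists>ys. list_all2 (\<lambda>g y. eval g (drop (Suc m) zs) = Some y) gs ys \<and> Q (rev ys @ zs))"
    by (rule Cons.IH) (use Cons.prems in auto)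
  ultimately have "semidecidable (Suc (m + k))
    (\<lambda>zs. eval g (drop (Suc m) zs) = Some (zs ! 0) \<and>
      (\<exists>ys. list_all2 (\<lambda>g y. eval g (drop (Suc m) zs) = Some y) gs ys \<and> Q (rev ys @ zs)))"
    by (auto intro: semidecidable_conj)
  then have "semidecidable (m + k)
    (\<lambda>zs. \<exists>y. eval g (drop m zs) = Some y \<and>
      (\<exists>ys. list_all2 (\<lambda>g y. eval g (drop m zs) = Some y) gs ys \<and> Q (rev ys @ y # zs)))"
    by (auto dest: semidecidable_ex)
  then show ?case
    by (rule semidecidable_cong)
      (simp add: list_all2_Cons1, metis append_Cons append_Nil append_assoc rev.simps(2))
qed

text \<open>The head of the list is the output, the tail the input. The arity is arbitrary in the
  induction because compound terms evaluate their subterms at other arities.\<close>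

lemma semidecidable_graph: "semidecidable (Suc k) (\<lambda>xs. eval f (tl xs) = Some (hd xs))"
proof (induction f arbitrary: k)
  case Zero
  have "semidecidable (Suc k) (\<lambda>xs. xs ! 0 = 0)"
    by (intro semidecidable_decidable computable) auto
  then show ?case
    by (rule semidecidable_cong) (auto simp: length_Suc_conv)
next
  case Succ
  \<comment> \<open>The conditional index stays in range for every \<open>k\<close>; for
    \<open>k \<noteq> 1\<close> the first conjunct empties the relation, as \<open>Succ\<close> is
    then undefined.\<close>
  have "semidecidable (Suc k) (\<lambda>xs. k = 1 \<and> xs ! 0 = Suc (xs ! (if k = 1 then 1 else 0)))"
    by (intro semidecidable_decidable computable) auto
  then show ?case
    by (rule semidecidable_cong) (auto simp: length_Suc_conv split: list.splits)
next
  case (Proj i)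
  have "semidecidable (Suc k) (\<lambda>xs. i < k \<and> xs ! 0 = xs ! (if i < k then Suc i else 0))"
    by (intro semidecidable_decidable computable) auto
  then show ?case
    by (rule semidecidable_cong) (auto simp: length_Suc_conv)
next
  case (Comp f gs)
  let ?l = "length gs"
  \<comment> \<open>On \<open>rev ys @ zs\<close>, position \<open>?l\<close> holds the output, and
    reversing the entries before it restores the order of the guessed values.\<close>
  let ?Gs = "(\<lambda>xs. xs ! ?l) # rev (map (\<lambda>j xs. xs ! j) [0..<?l])"
  let ?Q = "\<lambda>xs. eval f (tl xs) = Some (hd xs)"
  have "semidecidable (?l + Suc k + 0)
      (\<lambda>xs. ?Q (map (\<lambda>G. G xs) ?Gs @ drop (?l + Suc k) xs))"
    by (rule semidecidable_subst) (use Comp.IH(1) in \<open>auto intro!: computable\<close>)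
  then have "semidecidable (?l + (1 + k)) (\<lambda>xs. ?Q (map (\<lambda>G. G xs) ?Gs @ drop (?l + Suc k) xs))"
    by simp
  from semidecidable_ex_list_all2[OF Comp.IH(2) this]
  have *: "semidecidable (Suc k)
    (\<lambda>zs. \<exists>ys. list_all2 (\<lambda>g y. eval g (drop 1 zs) = Some y) gs ys \<and>
      ?Q (map (\<lambda>G. G (rev ys @ zs)) ?Gs @ drop (?l + Suc k) (rev ys @ zs)))"
    by simp
  have eq: "?Q (map (\<lambda>G. G (rev ys @ zs)) ?Gs @ drop (?l + Suc k) (rev ys @ zs)) \<longleftrightarrow>
      eval f ys = Some (hd zs)" if "length zs = Suc k" "length ys = ?l" for ys zs
  proof -
    have "map (\<lambda>j. (rev ys @ zs) ! j) [0..<?l] = rev ys"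
      using that by (intro nth_equalityI) (auto simp: nth_append)
    moreover have "(rev ys @ zs) ! ?l = hd zs"
      using that by (cases zs) (auto simp: nth_append)
    ultimately have "map (\<lambda>G. G (rev ys @ zs)) ?Gs = hd zs # ys"
      by (simp only: list.map rev_map[symmetric] map_map comp_def rev_rev_ident)
    then show ?thesis
      using that by simp
  qed
  show ?case
  proof (rule semidecidable_cong[OF *])
    fix zs :: "nat list"
    assume len: "length zs = Suc k"
    have "list_all2 (\<lambda>g y. eval g (drop 1 zs) = Some y) gs ys \<and>
        ?Q (map (\<lambda>G. G (rev ys @ zs)) ?Gs @ drop (?l + Suc k) (rev ys @ zs)) \<longleftrightarrow>
      list_all2 (\<lambda>g y. eval g (tl zs) = Some y) gs ys \<and> eval f ys = Some (hd zs)" for ys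
    proof (cases "length ys = ?l")
      case True
      show ?thesis
        unfolding eq[OF len True] by (simp add: drop_Suc)
    qed (auto dest: list_all2_lengthD)
    then show "(\<exists>ys. list_all2 (\<lambda>g y. eval g (drop 1 zs) = Some y) gs ys \<and>
        ?Q (map (\<lambda>G. G (rev ys @ zs)) ?Gs @ drop (?l + Suc k) (rev ys @ zs))) \<longleftrightarrow>
      eval (Comp f gs) (tl zs) = Some (hd zs)"
      by (simp only: eval_Comp_eq_Some_iff)
  qed
next
  case (Prec f g)
  show ?case
  proof (cases k)
    case 0
    \<comment> \<open>Without a recursion argument the value is undefined, so the graph is
      empty.\<close>
    have "semidecidable (Suc k) (\<lambda>xs. xs ! 0 < 0)"
      by (intro semidecidable_decidable computable) auto
    then show ?thesis
      by (rule semidecidable_cong) (auto simp: length_Suc_conv 0)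
  next
    case (Suc l)
    \<comment> \<open>The argument order is \<open>c # b # v # n # ys\<close>, with output
      \<open>v\<close>; the digits of \<open>c\<close> in base \<open>b\<close> are the intermediate
      values.\<close>
    let ?f = "\<lambda>xs. eval f (tl xs) = Some (hd xs)" and ?g = "\<lambda>xs. eval g (tl xs) = Some (hd xs)"
    let ?Gs = "[\<lambda>xs. digit (xs ! 2) (xs ! 1) (Suc (xs ! 0)), \<lambda>xs. xs ! 0,
        \<lambda>xs. digit (xs ! 2) (xs ! 1) (xs ! 0)]"
    let ?A = "\<lambda>xs. ?f (map (\<lambda>G. G xs) [\<lambda>xs. digit (xs ! 1) (xs ! 0) 0] @ drop 4 xs)"
    let ?B = "\<lambda>xs. \<forall>i<xs ! 3. ?g (map (\<lambda>G. G (i # xs)) ?Gs @ drop 5 (i # xs))"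
    let ?C = "\<lambda>xs. digit (xs ! 1) (xs ! 0) (xs ! 3) = xs ! 2"
    have "semidecidable (4 + l) ?A"
      by (rule semidecidable_subst) (use Prec.IH(1) in \<open>auto intro!: computable\<close>)
    moreover have "semidecidable (5 + l) (\<lambda>xs. ?g (map (\<lambda>G. G xs) ?Gs @ drop 5 xs))"
      by (rule semidecidable_subst) (use Prec.IH(2)[of "Suc (Suc l)"] in \<open>auto intro!: computable\<close>)
    then have "semidecidable (4 + l) ?B"
      by (intro semidecidable_ball) (auto simp: eval_nat_numeral intro: total_rec_nth)
    moreover have "semidecidable (4 + l) ?C"
      by (intro semidecidable_decidable computable) auto
    ultimately have "semidecidable (4 + l) (\<lambda>xs. ?A xs \<and> ?B xs \<and> ?C xs)"
      by (intro semidecidable_conj)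
    moreover have "4 + l = Suc (Suc (Suc k))"
      by (simp add: Suc)
    ultimately have "semidecidable (Suc (Suc (Suc k))) (\<lambda>xs. ?A xs \<and> ?B xs \<and> ?C xs)"
      by (simp only:)
    from this[THEN semidecidable_ex, THEN semidecidable_ex]
    show ?thesis
    proof (rule semidecidable_cong)
      fix xs :: "nat list"
      assume "length xs = Suc k"
      then obtain v n ys where xs: "xs = v # n # ys"
        by (auto simp: Suc length_Suc_conv)
      have "(\<exists>b c. eval f ys = Some (digit b c 0) \<and>
            (\<forall>i<n. eval g (i # digit b c i # ys) = Some (digit b c (Suc i))) \<and>
            digit b c n = v)
        \<longleftrightarrow> eval (Prec f g) (n # ys) = Some v"
        unfolding eval_Prec_eq_Some_iff
      proof
        assume "\<exists>a. eval f ys = Some (a 0) \<and>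
          (\<forall>i<n. eval g (i # a i # ys) = Some (a (Suc i))) \<and> a n = v"
        then obtain a where a: "eval f ys = Some (a 0)" "a n = v"
          "\<And>i. i < n \<Longrightarrow> eval g (i # a i # ys) = Some (a (Suc i))"
          by blast
        obtain b c where "\<forall>i\<le>n. digit b c i = a i"
          using ex_digits by blast
        then show "\<exists>b c. eval f ys = Some (digit b c 0) \<and>
            (\<forall>i<n. eval g (i # digit b c i # ys) = Some (digit b c (Suc i))) \<and>
            digit b c n = v"
          using a by (intro exI[of _ b] exI[of _ c]) auto
      qed blast
      then show "(\<exists>b c. ?A (c # b # xs) \<and> ?B (c # b # xs) \<and> ?C (c # b # xs)) \<longleftrightarrow>
          eval (Prec f g) (tl xs) = Some (hd xs)"
        unfolding xs by (simp del: eval.simps)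
    qed
  qed
next
  case (Mu f)
  let ?f = "\<lambda>xs. eval f (tl xs) = Some (hd xs)"
  let ?A = "\<lambda>xs. ?f (map (\<lambda>G. G xs) [\<lambda>xs. 0, \<lambda>xs. xs ! 0] @ drop 1 xs)"
  \<comment> \<open>The list is \<open>v # m # n # ys\<close>; the output \<open>n\<close> is
    dropped, and \<open>f\<close> takes the value \<open>Suc v\<close> on
    \<open>m # ys\<close>.\<close>
  let ?B = "\<lambda>xs. ?f (map (\<lambda>G. G xs) [\<lambda>xs. Suc (xs ! 0), \<lambda>xs. xs ! 1] @ drop 3 xs)"
  have A: "semidecidable (1 + k) ?A"
    by (rule semidecidable_subst) (use Mu.IH[of "Suc k"] in \<open>auto intro!: computable\<close>)
  have "semidecidable (3 + k) ?B"
    by (rule semidecidable_subst) (use Mu.IH[of "Suc k"] in \<open>auto intro!: computable\<close>)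
  then have "semidecidable (Suc k) (\<lambda>xs. \<forall>m<xs ! 0. \<exists>v. ?B (v # m # xs))"
    by (intro semidecidable_ball semidecidable_ex) (auto simp: numeral_3_eq_3 intro: total_rec_nth)
  with A have "semidecidable (Suc k) (\<lambda>xs. ?A xs \<and> (\<forall>m<xs ! 0. \<exists>v. ?B (v # m # xs)))"
    by (intro semidecidable_conj) auto
  then show ?case
    by (rule semidecidable_cong)
      (auto simp: eval_Mu_eq_Some_iff length_Suc_conv simp del: eval.simps)
qed

text \<open>Arbitrary \<open>F\<close>, \<open>G\<close> and \<open>H\<close> allow for both
  argument orders of the selector in the edge relation.\<close>

lemma semidecidable_graph2:
  assumes "partial_recursive2 \<psi>" "total_rec 2 F" "total_rec 2 G" "total_rec 2 H"
  shows "semidecidable 2 (\<lambda>xs. \<psi> (F xs, G xs) = Some (H xs))"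
proof -
  obtain f where f: "\<And>x y. \<psi> (x, y) = eval f [x, y]"
    using assms(1) by (auto simp: partial_recursive2_def)
  have "semidecidable (2 + 0) (\<lambda>xs. (\<lambda>xs. eval f (tl xs) = Some (hd xs))
      (map (\<lambda>G. G xs) [H, F, G] @ drop 2 xs))"
    by (rule semidecidable_subst) (use semidecidable_graph[of 2 f] assms in \<open>auto simp: numeral_2_eq_2\<close>)
  then have "semidecidable 2 (\<lambda>xs. eval f (F xs # G xs # drop 2 xs) = Some (H xs))"
    by simp
  then show ?thesis
    by (rule semidecidable_cong) (simp add: f)
qed

text \<open>A domain is the projection of a graph. Conversely, minimisation of a total decision
  procedure is defined exactly where a witness exists.\<close>

lemma re_rel_iff_semidecidable: "re_rel R \<longleftrightarrow> semidecidable 2 (\<lambda>xs. (xs ! 0, xs ! 1) \<in> R)"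
proof
  assume "re_rel R"
  then obtain f where f: "\<And>x y. (x, y) \<in> R \<longleftrightarrow> (\<exists>v. eval f [x, y] = Some v)"
    by (auto simp: re_rel_def partial_recursive2_def dom_def)
  have "semidecidable 2 (\<lambda>xs. \<exists>v. eval f xs = Some v)"
    using semidecidable_ex[OF semidecidable_graph, of 2 f] by simp
  then show "semidecidable 2 (\<lambda>xs. (xs ! 0, xs ! 1) \<in> R)"
    by (rule semidecidable_cong) (auto simp: f numeral_2_eq_2 length_Suc_conv)
next
  assume "semidecidable 2 (\<lambda>xs. (xs ! 0, xs ! 1) \<in> R)"
  then obtain D where D: "decidable 3 D"
    and R: "\<And>xs. length xs = 2 \<Longrightarrow> (xs ! 0, xs ! 1) \<in> R \<longleftrightarrow> (\<exists>t. D (t # xs))"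
    by (auto elim!: semidecidableE simp: numeral_2_eq_2 numeral_3_eq_3)
  obtain f where f: "\<And>xs. length xs = 3 \<Longrightarrow> eval f xs = Some (if D xs then 0 else 1)"
    using D by (auto simp: decidable_def total_rec_def)
  have "(x, y) \<in> R \<longleftrightarrow> eval (Mu f) [x, y] \<noteq> None" for x y
    using R[of "[x, y]"] by (simp add: f)
  then have "R = dom (\<lambda>(x, y). eval (Mu f) [x, y])"
    by (auto simp: dom_def simp del: eval.simps)
  then show "re_rel R"
    unfolding re_rel_def partial_recursive2_def
    by (intro exI[of _ "\<lambda>(x, y). eval (Mu f) [x, y]"] conjI exI[of _ "Mu f"])
      (simp_all del: eval.simps)
qed


section \<open>Selectors and quasi-orderings\<close>

text \<open>A single search looks for a witness of either orientation of the pair; the first one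
  found shows which orientation to trust.\<close>

lemma ex_semidecidable_selector:
  assumes "re_rel R"
  obtains \<psi> where "partial_recursive2 \<psi>"
    "\<And>x y. (x, y) \<in> R \<or> (y, x) \<in> R \<Longrightarrow>
      \<psi> (x, y) = Some x \<and> (x, y) \<in> R \<or> \<psi> (x, y) = Some y \<and> (y, x) \<in> R"
proof -
  obtain D where D: "decidable 3 D"
    and R: "\<And>xs. length xs = 2 \<Longrightarrow> (xs ! 0, xs ! 1) \<in> R \<longleftrightarrow> (\<exists>t. D (t # xs))"
    using assms
    by (auto simp: re_rel_iff_semidecidable numeral_2_eq_2 numeral_3_eq_3 elim!: semidecidableE)
  let ?swap = "[\<lambda>xs. xs ! 0, \<lambda>xs. xs ! 2, \<lambda>xs. xs ! 1] :: (nat list \<Rightarrow> nat) list"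
  let ?P = "\<lambda>xs. D xs \<or> D (map (\<lambda>G. G xs) ?swap @ drop 3 xs)"
  have "decidable (3 + 0) (\<lambda>xs. D (map (\<lambda>G. G xs) ?swap @ drop 3 xs))"
    by (rule decidable_subst) (use D in \<open>auto simp: numeral_3_eq_3 intro!: computable\<close>)
  then have "decidable 3 ?P"
    using D by (intro decidable_disj) simp_all
  then obtain f where f: "\<And>xs. length xs = 3 \<Longrightarrow> eval f xs = Some (if ?P xs then 0 else 1)"
    by (auto simp: decidable_def total_rec_def)
  \<comment> \<open>If the stage found witnesses both orientations, \<open>x\<close> is chosen;
    either choice would be correct.\<close>
  have "total_rec 3 (\<lambda>xs. if D xs then xs ! 1 else xs ! 2)"
    by (intro total_rec_If D total_rec_nth) auto
  then obtain h where h: "\<And>xs. length xs = 3 \<Longrightarrow> eval h xs = Some (if D xs then xs ! 1 else xs ! 2)"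
    by (auto simp: total_rec_def)
  let ?\<psi> = "\<lambda>(x, y). eval (Comp h [Mu f, Proj 0, Proj 1]) [x, y]"
  have "partial_recursive2 ?\<psi>"
    unfolding partial_recursive2_def by (simp only: case_prod_conv) blast
  moreover have "?\<psi> (x, y) = Some x \<and> (x, y) \<in> R \<or> ?\<psi> (x, y) = Some y \<and> (y, x) \<in> R"
    if "(x, y) \<in> R \<or> (y, x) \<in> R" for x y
  proof -
    let ?t = "LEAST t. D [t, x, y] \<or> D [t, y, x]"
    have ex: "\<exists>t. D [t, x, y] \<or> D [t, y, x]"
      using that R[of "[x, y]"] R[of "[y, x]"] by auto
    then have "eval (Mu f) [x, y] = Some ?t"
      by (simp add: f)
    then have "?\<psi> (x, y) = Some (if D [?t, x, y] then x else y)"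
      by (simp add: h del: eval.simps(6))
    moreover have "D [?t, x, y] \<or> D [?t, y, x]"
      using ex by (rule LeastI_ex)
    ultimately show ?thesis
      using R[of "[x, y]"] R[of "[y, x]"] by auto
  qed
  ultimately show thesis
    by (rule that)
qed

theorem theorem5:
  fixes M :: "nat set"
  shows "semi_re M \<longleftrightarrow>
    (\<exists>R :: nat rel. preorder_on UNIV R \<and> re_rel R \<and> initial_segment M R \<and> total_on M R)"
proof
  assume "semi_re M"
  then obtain \<psi> where \<psi>: "partial_recursive2 \<psi>"
    and sel: "\<And>x y. x \<in> M \<or> y \<in> M \<Longrightarrow> \<exists>z. \<psi> (x, y) = Some z \<and> z \<in> {x, y} \<inter> M"
    unfolding semi_re_def by blast
  define E where "E x y \<longleftrightarrow> \<psi> (x, y) = Some x \<or> \<psi> (y, x) = Some x" for x y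
  define R where "R = {(x, y). E\<^sup>*\<^sup>* x y}"
  \<comment> \<open>If \<open>\<psi> (x, y)\<close> is \<open>y\<close>, the second disjunct of
    \<open>E y x\<close> applies; \<open>\<psi>\<close> need not be symmetric.\<close>
  have edge: "E x y \<or> E y x" if "x \<in> M" for x y
    using sel[of x y] that by (auto simp: E_def)
  have down: "x \<in> M" if "E\<^sup>*\<^sup>* x y" "y \<in> M" for x y
    using that
  proof (induction rule: converse_rtranclp_induct)
    case (step x z)
    \<comment> \<open>Since \<open>z \<in> M\<close>, the selector returns an element of
      \<open>M\<close> on \<open>x\<close> and \<open>z\<close> in either order, and the edge says
      that in one order this element is \<open>x\<close>.\<close>
    then show ?case
      using sel[of x z] sel[of z x] by (auto simp: E_def)
  qed
  have "semidecidable 2 (\<lambda>xs. E (xs ! 0) (xs ! 1))"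
    unfolding E_def by (intro semidecidable_disj semidecidable_graph2 \<psi> total_rec_nth) auto
  then have "re_rel R"
    using semidecidable_rtranclp by (simp add: re_rel_iff_semidecidable R_def)
  moreover have "preorder_on UNIV R"
    by (auto simp: preorder_on_def refl_on_def R_def intro: transI)
  moreover have "initial_segment M R"
    \<comment> \<open>By \<open>down\<close>, no path leads from outside \<open>M\<close> into
      \<open>M\<close>, so the edge supplied by \<open>edge\<close> must start in
      \<open>M\<close>.\<close>
    using edge down unfolding initial_segment_def R_def by blast
  moreover have "total_on M R"
    using edge unfolding total_on_def R_def by blast
  ultimately show "\<exists>R. preorder_on UNIV R \<and> re_rel R \<and> initial_segment M R \<and> total_on M R"
    by blast
next
  assume "\<exists>R. preorder_on UNIV R \<and> re_rel R \<and> initial_segment M R \<and> total_on M R"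
  then obtain R where R: "preorder_on UNIV R" "re_rel R" "initial_segment M R" "total_on M R"
    by blast
  obtain \<psi> where \<psi>: "partial_recursive2 \<psi>"
    and sel: "\<And>x y. (x, y) \<in> R \<or> (y, x) \<in> R \<Longrightarrow>
      \<psi> (x, y) = Some x \<and> (x, y) \<in> R \<or> \<psi> (x, y) = Some y \<and> (y, x) \<in> R"
    using ex_semidecidable_selector[OF R(2)] by blast
  have "\<exists>z. \<psi> (x, y) = Some z \<and> z \<in> {x, y} \<inter> M" if "x \<in> M \<or> y \<in> M" for x y
  proof -
    \<comment> \<open>\<open>total_on\<close> compares only distinct elements; reflexivity covers
      the case \<open>x = y\<close>.\<close>
    have "(x, x) \<in> R"
      using R(1) by (auto simp: preorder_on_def refl_on_def)
    then have "(x, y) \<in> R \<or> (y, x) \<in> R"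
      using that R(3,4) unfolding initial_segment_def total_on_def
      by (cases "x = y"; cases "x \<in> M"; cases "y \<in> M") auto
    \<comment> \<open>If \<open>a\<close> were outside \<open>M\<close>, then \<open>b\<close> would
      be strictly below \<open>a\<close>, against \<open>(a, b) \<in> R\<close>.\<close>
    moreover have "a \<in> M" if "(a, b) \<in> R" "b \<in> M" for a b
      using that R(3) unfolding initial_segment_def by blast
    ultimately show ?thesis
      using sel[of x y] that by auto
  qed
  then show "semi_re M"
    unfolding semi_re_def using \<psi> by blast
qed

end
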